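(* For every integer $t\geq 2$ there exists a connected non-regular harmonic-uniform graph $F_t$ with a single cut-vertex (i.e. exactly one cut-vertex) such that $|V(F_t)|=48t+1$ and $\operatorname{diam}(F_t)=4$.
   Context: Graphs are finite, without loops or multiple edges. For a connected graph $G$, $d(u,v)$ denotes the distance (length of a shortest $u$-$v$-path). The harmonic centrality of a vertex $x$ of $G$ is $H_G(x)=\sum_{u\in V(G),\,u\neq x}\frac{1}{d(u,x)}$. The harmonic center $\mathcal{C}_H(G)$ is the subgraph of $G$ induced by the vertices with maximum harmonic centrality. $G$ is harmonic-uniform if $\mathcal{C}_H(G)\cong G$, i.e. all vertices of $G$ have the same harmonic centrality. A graph is non-regular if its vertices do not all have the same degree. *)

theory Defs
  imports "Graph_Theory.Graph_Theory"
begin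

text \<open>
  A finite simple graph is a \<^locale>\<open>pair_graph\<close>: a finite vertex set with a symmetric,
  irreflexive arc relation, each edge being represented by its two opposite arcs.
  The notions below are meant for such graphs, so that the degree is the
  \<^const>\<open>out_degree\<close> and the length of an undirected path is its number of arcs.
\<close>

text \<open>If \<open>v\<close> is not reachable from \<open>u\<close>, the value of \<open>graph_dist G u v\<close> is unspecified.\<close>

definition graph_dist :: "('a, 'b) pre_digraph \<Rightarrow> 'a \<Rightarrow> 'a \<Rightarrow> nat" where
  "graph_dist G u v = (LEAST n. \<exists>p. pre_digraph.apath G u p v \<and> length p = n)"

definition graph_diam :: "('a, 'b) pre_digraph \<Rightarrow> nat" where
  "graph_diam G = Max {graph_dist G u v | u v. u \<in> verts G \<and> v \<in> verts G}"

definition harmonic_centrality :: "('a, 'b) pre_digraph \<Rightarrow> 'a \<Rightarrow> real" where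
  "harmonic_centrality G x = (\<Sum>u \<in> verts G - {x}. 1 / real (graph_dist G u x))"

definition harmonic_center :: "('a, 'b) pre_digraph \<Rightarrow> ('a, 'b) pre_digraph" where
  "harmonic_center G =
     G \<restriction> {x \<in> verts G. \<forall>y \<in> verts G. harmonic_centrality G y \<le> harmonic_centrality G x}"

definition harmonic_uniform :: "('a, 'b) pre_digraph \<Rightarrow> bool" where
  "harmonic_uniform G \<longleftrightarrow> digraph_iso (harmonic_center G) G"

definition regular_graph :: "('a, 'b) pre_digraph \<Rightarrow> bool" where
  "regular_graph G \<longleftrightarrow> (\<forall>u \<in> verts G. \<forall>v \<in> verts G. out_degree G u = out_degree G v)"

text \<open>A cut-vertex separates two other vertices of the same component.\<close>

definition cut_vertex :: "('a, 'b) pre_digraph \<Rightarrow> 'a \<Rightarrow> bool" where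
  "cut_vertex G v \<longleftrightarrow> v \<in> verts G \<and>
     (\<exists>x \<in> verts G - {v}. \<exists>y \<in> verts G - {v}.
        x \<rightarrow>\<^sup>*\<^bsub>G\<^esub> y \<and> \<not> x \<rightarrow>\<^sup>*\<^bsub>pre_digraph.del_vert G v\<^esub> y)"

lemma harmonic_uniform_iff:
  assumes "fin_digraph G"
  shows "harmonic_uniform G \<longleftrightarrow>
    (\<forall>x \<in> verts G. \<forall>y \<in> verts G. harmonic_centrality G x = harmonic_centrality G y)"
    (is "_ \<longleftrightarrow> ?R")
proof -
  interpret fin_digraph G by fact
  let ?S = "{x \<in> verts G. \<forall>y \<in> verts G. harmonic_centrality G y \<le> harmonic_centrality G x}"
  show ?thesis
  proof
    assume "harmonic_uniform G"
    then obtain f where f: "pre_digraph.digraph_isomorphism (harmonic_center G) f"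
      "G = app_iso f (harmonic_center G)"
      unfolding harmonic_uniform_def digraph_iso_def by blast
    have "inj_on (iso_verts f) ?S"
      using f(1) by (simp add: pre_digraph.digraph_isomorphism_def harmonic_center_def)
    moreover have "verts G = iso_verts f ` ?S"
      by (subst f(2)) (simp add: verts_app_iso harmonic_center_def)
    ultimately have "card (verts G) = card ?S" by (metis (no_types, lifting) card_image)
    then have "?S = verts G"
      by (intro card_subset_eq) auto
    then have "harmonic_centrality G y \<le> harmonic_centrality G x"
      if "x \<in> verts G" "y \<in> verts G" for x y
      using that by blast
    then show ?R by (meson order_antisym)
  next
    assume R: ?R
    have le: "harmonic_centrality G y \<le> harmonic_centrality G x"
      if "x \<in> verts G" "y \<in> verts G" for x y
      using R[rule_format, OF that] by (rule eq_refl[OF sym])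
    have S: "?S = verts G" using le by blast
    have *: "harmonic_center G = G"
      unfolding harmonic_center_def S
      by (rule pre_digraph.equality) (auto simp: induce_subgraph_def)
    have "digraph_isomorphism \<lparr>iso_verts = id, iso_arcs = id, iso_head = head G, iso_tail = tail G\<rparr>"
      by (simp add: digraph_isomorphism_def wf_digraph)
    moreover have
      "G = app_iso \<lparr>iso_verts = id, iso_arcs = id, iso_head = head G, iso_tail = tail G\<rparr> G"
      by (simp add: app_iso_def)
    ultimately show "harmonic_uniform G"
      unfolding harmonic_uniform_def * digraph_iso_def by blast
  qed
qed

lemma cut_vertex_iff:
  assumes "graph G" and "Digraph_Component.connected G" and "v \<in> verts G" and "verts G \<noteq> {v}"
  shows "cut_vertex G v \<longleftrightarrow> \<not> Digraph_Component.connected (pre_digraph.del_vert G v)"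
proof -
  interpret graph G by fact
  interpret D: wf_digraph "del_vert v" by (rule wf_digraph_del_vert)
  have "arcs_ends (del_vert v) = {(a, b) \<in> arcs_ends G. a \<noteq> v \<and> b \<noteq> v}"
    by (auto simp: arcs_ends_conv del_vert_simps)
  then have "symmetric (del_vert v)"
    using sym_arcs unfolding symmetric_def sym_def by blast
  then interpret D: sym_digraph "del_vert v" by unfold_locales
  have sc: "strongly_connected G"
    using symmetric_connected_imp_strongly_connected[OF sym_arcs assms(2)] .
  have "Digraph_Component.connected (del_vert v) \<longleftrightarrow> strongly_connected (del_vert v)"
    by (simp add: Digraph_Component.connected_def strongly_connected_def
        D.reachable_mk_symmetric_eq[OF D.sym_arcs])
  then show ?thesis
    using assms(3,4) sc unfolding cut_vertex_def strongly_connected_def verts_del_vert by blast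
qed

end

theory Submission
  imports Defs
begin

text \<open>
  The graph consists of two copies of a graph, its branches, joined at a single vertex \<open>z\<close>. A branch
  has \<open>6 t\<close> inner vertices, adjacent to \<open>z\<close>, and \<open>18 t\<close> outer vertices, at distance two from
  \<open>z\<close>, and any two of its vertices have distance at most two. Every path between the branches passes
  through \<open>z\<close>, so the distance of two vertices in different branches is the sum of their distances
  from \<open>z\<close>; this gives diameter four. Inside a branch the distance is one or two, depending only on
  adjacency. The harmonic centrality of a vertex is therefore determined by its distance from \<open>z\<close> and
  its degree, and equality of all centralities comes down to two linear equations: inner vertices
  must have degree \<open>18 t\<close> and outer vertices degree \<open>23 t\<close> (locale \<open>balanced_gluing\<close>). As \<open>z\<close> has
  degree \<open>12 t\<close>, the graph is not regular.

  It remains to find a branch with these degrees in which the distances are at most two and each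
  outer vertex has at least two inner neighbours, so that \<open>z\<close> is the only cut-vertex. In
  a branch of order \<open>24 t\<close> such degrees leave few non-adjacent pairs, and these can be prescribed block
  by block (\<open>outer_gap\<close>, \<open>card_neighbours_inner\<close>, \<open>card_neighbours_outer\<close>). The assumption \<open>t \<ge> 2\<close>
  enters here: the outer vertices with an inner non-neighbour need \<open>t - 2\<close> outer
  non-neighbours.
\<close>

section \<open>Distances and walks\<close>

context wf_digraph
begin

text \<open>Distances are minima over paths, but walks compose freely; cutting out cycles only shortens
  a walk, so every walk gives an upper bound for the distance.\<close>

lemma apath_shorter_than_awalk:
  assumes "awalk u p v"
  shows "\<exists>q. apath u q v \<and> length q \<le> length p"
  using assms
proof (induct rule: awalk_to_apath_induct)
  case (path p)
  then show ?case by (auto simp: apath_def)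
next
  case (decomp p q r s)
  from decomp(2,1,3) have "length (q @ s) \<le> length p"
    by (rule awalk_cyc_decompE) auto
  with decomp(4) show ?case by (meson le_trans)
qed

lemma graph_dist_le_awalk:
  assumes "awalk u p v"
  shows "graph_dist G u v \<le> length p"
proof -
  obtain q where q: "apath u q v" "length q \<le> length p"
    using apath_shorter_than_awalk[OF assms] by blast
  have "graph_dist G u v \<le> length q"
    unfolding graph_dist_def by (rule Least_le) (use q in blast)
  with q show ?thesis by simp
qed

lemma graph_dist_attained:
  assumes "u \<rightarrow>\<^sup>* v"
  obtains p where "awalk u p v" "length p = graph_dist G u v"
proof -
  have "\<exists>n p. apath u p v \<and> length p = n"
    using assms by (auto simp: reachable_apath)
  then have "\<exists>p. apath u p v \<and> length p = graph_dist G u v"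
    unfolding graph_dist_def by (rule LeastI_ex)
  then show ?thesis using that by (auto simp: apath_def)
qed

lemma graph_dist_triangle:
  assumes "u \<rightarrow>\<^sup>* v" "v \<rightarrow>\<^sup>* w"
  shows "graph_dist G u w \<le> graph_dist G u v + graph_dist G v w"
proof -
  obtain p where p: "awalk u p v" "length p = graph_dist G u v"
    using assms(1) by (rule graph_dist_attained)
  obtain q where q: "awalk v q w" "length q = graph_dist G v w"
    using assms(2) by (rule graph_dist_attained)
  show ?thesis
    using graph_dist_le_awalk[OF awalk_appendI[OF p(1) q(1)]] p(2) q(2) by simp
qed

text \<open>Lower bounds come from labellings: if the label changes by at most one along each arc, a walk
  needs at least as many arcs as the labels of its ends differ.\<close>

lemma lipschitz_awalk:
  fixes f :: "'a \<Rightarrow> int"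
  assumes "\<And>e. e \<in> arcs G \<Longrightarrow> \<bar>f (tail G e) - f (head G e)\<bar> \<le> 1"
    and "awalk u p v"
  shows "\<bar>f u - f v\<bar> \<le> int (length p)"
  using assms(2)
proof (induct p arbitrary: u)
  case Nil
  then show ?case by (simp add: awalk_Nil_iff)
next
  case (Cons e p)
  then have "e \<in> arcs G" "u = tail G e" "\<bar>f (head G e) - f v\<bar> \<le> int (length p)"
    by (auto simp: awalk_Cons_iff)
  with assms(1)[of e] show ?case by simp
qed

lemma lipschitz_le_graph_dist:
  fixes f :: "'a \<Rightarrow> int"
  assumes "\<And>e. e \<in> arcs G \<Longrightarrow> \<bar>f (tail G e) - f (head G e)\<bar> \<le> 1"
    and "u \<rightarrow>\<^sup>* v"
  shows "\<bar>f u - f v\<bar> \<le> int (graph_dist G u v)"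
  using assms(2) by (rule graph_dist_attained) (metis assms(1) lipschitz_awalk)

lemma graph_dist_refl:
  assumes "u \<in> verts G"
  shows "graph_dist G u u = 0"
  using graph_dist_le_awalk[of u "[]" u] assms by (simp add: awalk_Nil_iff)

lemma graph_dist_adjacent:
  assumes "u \<rightarrow> v" "u \<noteq> v"
  shows "graph_dist G u v = 1"
proof -
  obtain e where e: "e \<in> arcs G" "tail G e = u" "head G e = v"
    using assms(1) by (auto simp: arcs_ends_conv)
  have "graph_dist G u v \<le> 1"
    using graph_dist_le_awalk[OF arc_implies_awalk[OF e(1)]] e by simp
  moreover have "graph_dist G u v \<noteq> 0"
  proof
    assume "graph_dist G u v = 0"
    then obtain p where "awalk u p v" "p = []"
      using graph_dist_attained[OF reachable_adjI[OF assms(1)]] by force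
    with assms(2) show False by (simp add: awalk_Nil_iff)
  qed
  ultimately show ?thesis by linarith
qed

lemma graph_dist_common_neighbour:
  assumes "u \<rightarrow> w" "w \<rightarrow> v" "u \<noteq> v" "\<not> u \<rightarrow> v"
  shows "graph_dist G u v = 2"
proof -
  have uw: "u \<rightarrow>\<^sup>* w" and wv: "w \<rightarrow>\<^sup>* v" and uv: "u \<rightarrow>\<^sup>* v"
    using assms(1,2) by (auto intro: reachable_adjI reachable_trans)
  have "graph_dist G u v \<le> 2"
    using graph_dist_triangle[OF uw wv] graph_dist_adjacent[OF assms(1)]
      graph_dist_adjacent[OF assms(2)] assms by (metis one_add_one)
  moreover have "graph_dist G u v \<noteq> 0" "graph_dist G u v \<noteq> 1"
  proof -
    obtain p where p: "awalk u p v" "length p = graph_dist G u v"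
      using uv by (rule graph_dist_attained)
    show "graph_dist G u v \<noteq> 0" using p assms(3) by (metis awalk_empty_ends length_0_conv)
    show "graph_dist G u v \<noteq> 1"
    proof
      assume "graph_dist G u v = 1"
      then obtain e where "p = [e]" using p(2) by (auto simp: length_Suc_conv)
      with p(1) assms(4) show False
        by (auto simp: awalk_simps intro: in_arcs_imp_in_arcs_ends)
    qed
  qed
  ultimately show ?thesis by linarith
qed

end

lemma length_rev_path: "length (rev_path p) = length p"
  by (induct p) auto

lemma (in pair_sym_digraph) graph_dist_sym: "graph_dist G u v = graph_dist G v u"
proof -
  have "(\<exists>p. apath u p v \<and> length p = n) \<longleftrightarrow> (\<exists>p. apath v p u \<and> length p = n)" for n
    by (metis apath_rev_path length_rev_path)
  then show ?thesis by (simp add: graph_dist_def)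
qed

section \<open>Two branches glued at a vertex\<close>

text \<open>
  The level of a vertex records its branch (by the sign) and its distance from the cut-vertex
  \<open>z\<close> (by the absolute value). Each branch has \<open>a\<close> inner and \<open>b\<close> outer vertices and, together with
  \<open>z\<close>, diameter at most two (\<open>common_neighbour\<close>). The second inner neighbour of an outer vertex
  keeps an inner vertex from being a cut-vertex.

  The two degree conditions are what equal centralities force. The levels determine
  distances between the branches, and inside a branch the distance is one or two according
  to adjacency, so the centralities of \<open>z\<close>, of an inner and of an outer vertex of degree \<open>d\<close> are
  \<open>2 a + b\<close>, \<open>1 + (a + b - 1)/2 + (d - 1)/2 + a/2 + b/3\<close> and
  \<open>1/2 + (a + b - 1)/2 + d/2 + a/3 + b/4\<close>. They agree iff \<open>d = 2 a + b/3\<close> for inner and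
  \<open>d = 7 a/3 + b/2\<close> for outer vertices.
\<close>

locale balanced_gluing = pair_graph G for G :: "'a pair_pre_digraph" +
  fixes lev :: "'a \<Rightarrow> int" and z :: 'a and a b :: nat
  assumes centre: "z \<in> pverts G"
    and lev_eq_0_iff: "v \<in> pverts G \<Longrightarrow> lev v = 0 \<longleftrightarrow> v = z"
    and lev_le_2: "v \<in> pverts G \<Longrightarrow> \<bar>lev v\<bar> \<le> 2"
    and lev_arc: "(u, v) \<in> parcs G \<Longrightarrow> \<bar>lev u - lev v\<bar> \<le> 1"
    and centre_arc: "v \<in> pverts G \<Longrightarrow> \<bar>lev v\<bar> = 1 \<Longrightarrow> (v, z) \<in> parcs G"
    and two_inner_neighbours: "v \<in> pverts G \<Longrightarrow> \<bar>lev v\<bar> = 2 \<Longrightarrow>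
      \<exists>x y. x \<noteq> y \<and> (v, x) \<in> parcs G \<and> (v, y) \<in> parcs G \<and> 2 * lev x = lev v \<and> 2 * lev y = lev v"
    and common_neighbour: "u \<in> pverts G \<Longrightarrow> v \<in> pverts G \<Longrightarrow> u \<noteq> v \<Longrightarrow> lev u * lev v > 0 \<Longrightarrow>
      (u, v) \<notin> parcs G \<Longrightarrow> \<exists>w. (u, w) \<in> parcs G \<and> (w, v) \<in> parcs G"
    and card_inner: "\<bar>k\<bar> = 1 \<Longrightarrow> card {v \<in> pverts G. lev v = k} = a"
    and card_outer: "\<bar>k\<bar> = 2 \<Longrightarrow> card {v \<in> pverts G. lev v = k} = b"
    and outer_pos: "b > 0"
    and degree_inner: "v \<in> pverts G \<Longrightarrow> \<bar>lev v\<bar> = 1 \<Longrightarrow> 3 * out_degree G v = 6 * a + b"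
    and degree_outer: "v \<in> pverts G \<Longrightarrow> \<bar>lev v\<bar> = 2 \<Longrightarrow> 6 * out_degree G v = 14 * a + 3 * b"
begin

lemma lev_centre: "lev z = 0"
  using centre lev_eq_0_iff by blast

lemma lev_cases:
  assumes "v \<in> pverts G"
  obtains (centre) "v = z" | (inner) "\<bar>lev v\<bar> = 1" | (outer) "\<bar>lev v\<bar> = 2"
proof -
  have "lev v = 0 \<or> \<bar>lev v\<bar> = 1 \<or> \<bar>lev v\<bar> = 2"
    using lev_le_2[OF assms] by linarith
  with that show ?thesis using lev_eq_0_iff[OF assms] by blast
qed

lemma exists_outer:
  assumes "\<bar>k\<bar> = 2"
  shows "\<exists>v \<in> pverts G. lev v = k"
proof -
  have "{v \<in> pverts G. lev v = k} \<noteq> {}"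
    using card_outer[OF assms] outer_pos by (metis card.empty less_irrefl)
  then show ?thesis by blast
qed

lemma awalk_to_centre:
  assumes "v \<in> pverts G"
  obtains p where "awalk v p z" "int (length p) = \<bar>lev v\<bar>"
  using assms
proof (cases rule: lev_cases)
  case centre
  then show ?thesis using that[of "[]"] assms lev_centre by (simp add: awalk_Nil_iff)
next
  case inner
  then show ?thesis
    using that[of "[(v, z)]"] centre_arc[OF assms] centre by (simp add: awalk_simps)
next
  case outer
  then obtain x where x: "(v, x) \<in> parcs G" "2 * lev x = lev v"
    using two_inner_neighbours[OF assms] by blast
  then have "(x, z) \<in> parcs G" using centre_arc[of x] outer by (auto dest: in_arcsD2)
  with x outer show ?thesis
    using that[of "[(v, x), (x, z)]"] centre by (simp add: awalk_simps)
qed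

lemma reachable_centre: "v \<in> pverts G \<Longrightarrow> v \<rightarrow>\<^sup>*\<^bsub>G\<^esub> z"
  by (metis awalk_to_centre reachable_awalk)

lemma reachable_all:
  assumes "u \<in> pverts G" "v \<in> pverts G"
  shows "u \<rightarrow>\<^sup>*\<^bsub>G\<^esub> v"
proof -
  have "z \<rightarrow>\<^sup>*\<^bsub>G\<^esub> v"
    using reachable_centre[OF assms(2)] by (metis awalk_rev_path reachable_awalk)
  with reachable_centre[OF assms(1)] show ?thesis by (rule reachable_trans)
qed

lemma connected: "Digraph_Component.connected G"
  unfolding Digraph_Component.connected_def
  using centre reachable_all
  by (intro strongly_connectedI) (auto simp: reachable_mk_symmetric_eq[OF sym_arcs])

lemma graph_dist_centre:
  assumes "v \<in> pverts G"
  shows "int (graph_dist G v z) \<le> \<bar>lev v\<bar>"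
  using assms by (rule awalk_to_centre) (metis graph_dist_le_awalk of_nat_le_iff)

text \<open>The level is a labelling that changes by at most one along arcs, and the detour through \<open>z\<close>
  attains the resulting lower bound.\<close>

lemma graph_dist_across:
  assumes "u \<in> pverts G" "v \<in> pverts G" "lev u * lev v \<le> 0"
  shows "int (graph_dist G u v) = \<bar>lev u - lev v\<bar>"
proof (rule antisym)
  have "graph_dist G u v \<le> graph_dist G u z + graph_dist G z v"
    using assms centre by (intro graph_dist_triangle reachable_all)
  then have "int (graph_dist G u v) \<le> \<bar>lev u\<bar> + \<bar>lev v\<bar>"
    using graph_dist_centre[OF assms(1)] graph_dist_centre[OF assms(2)]
      graph_dist_sym[of z v] by linarith
  also have "\<dots> = \<bar>lev u - lev v\<bar>"
    using assms(3) by (auto simp: mult_le_0_iff)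
  finally show "int (graph_dist G u v) \<le> \<bar>lev u - lev v\<bar>" .
  show "\<bar>lev u - lev v\<bar> \<le> int (graph_dist G u v)"
    using assms by (intro lipschitz_le_graph_dist reachable_all) (auto intro: lev_arc)
qed

lemma graph_dist_within:
  assumes "u \<in> pverts G" "v \<in> pverts G" "u \<noteq> v" "lev u * lev v > 0"
  shows "graph_dist G u v = (if (u, v) \<in> parcs G then 1 else 2)"
  using assms common_neighbour[OF assms] graph_dist_adjacent graph_dist_common_neighbour
  by auto

lemma graph_diam: "graph_diam G = 4"
proof -
  let ?D = "{graph_dist G u v |u v. u \<in> pverts G \<and> v \<in> pverts G}"
  have "?D = (\<lambda>(u, v). graph_dist G u v) ` (pverts G \<times> pverts G)"
    by auto
  then have fin: "finite ?D" by simp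
  have le: "graph_dist G u v \<le> 4" if "u \<in> pverts G" "v \<in> pverts G" for u v
  proof (cases "lev u * lev v > 0")
    case True
    then show ?thesis
      using graph_dist_within[OF that] graph_dist_refl[OF that(1)] by (cases "u = v") auto
  next
    case False
    then have "int (graph_dist G u v) = \<bar>lev u - lev v\<bar>"
      using that by (intro graph_dist_across) auto
    with lev_le_2[OF that(1)] lev_le_2[OF that(2)] show ?thesis by linarith
  qed
  obtain u v where uv: "u \<in> pverts G" "lev u = 2" "v \<in> pverts G" "lev v = -2"
    using exists_outer[of 2] exists_outer[of "-2"] by auto
  then have "graph_dist G u v = 4" using graph_dist_across[of u v] by simp
  with uv have "4 \<in> ?D" by force
  with fin le have "Max ?D = 4" by (intro Max_eqI) auto
  then show ?thesis by (simp add: graph_diam_def)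
qed

text \<open>A walk that changes the sign of the level has to pass through level zero.\<close>

lemma cut_vertex_centre: "cut_vertex G z"
proof -
  interpret D: wf_digraph "del_vert z" by (rule wf_digraph_del_vert)
  obtain u v where uv: "u \<in> pverts G" "lev u = 2" "v \<in> pverts G" "lev v = -2"
    using exists_outer[of 2] exists_outer[of "-2"] by auto
  have "\<not> u \<rightarrow>\<^sup>*\<^bsub>del_vert z\<^esub> v"
  proof
    assume "u \<rightarrow>\<^sup>*\<^bsub>del_vert z\<^esub> v"
    then have "lev v > 0"
    proof (induct rule: D.reachable_induct)
      case base
      then show ?case using uv by simp
    next
      case (step x y)
      have xy: "(x, y) \<in> parcs G" "x \<noteq> z" "y \<noteq> z"
        using step(2) by (auto simp: arcs_ends_conv del_vert_simps)
      then have "lev y \<noteq> 0" using lev_eq_0_iff[of y] by (auto dest: in_arcsD2)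
      with lev_arc[OF xy(1)] step(3) show ?case by linarith
    qed
    with uv show False by simp
  qed
  moreover have "u \<noteq> z" "v \<noteq> z" using uv lev_centre by auto
  ultimately show ?thesis
    using uv centre reachable_all[of u v] unfolding cut_vertex_def by auto
qed

text \<open>After deleting a vertex other than \<open>z\<close>, each outer vertex still has an inner neighbour, and
  hence every remaining vertex is still joined to \<open>z\<close>.\<close>

lemma cut_vertex_imp_centre:
  assumes "cut_vertex G v"
  shows "v = z"
proof (rule ccontr)
  assume vz: "v \<noteq> z"
  interpret D: wf_digraph "del_vert v" by (rule wf_digraph_del_vert)
  have arc: "x \<rightarrow>\<^bsub>del_vert v\<^esub> y" if "(x, y) \<in> parcs G" "x \<noteq> v" "y \<noteq> v" for x y
    using that by (force simp: arcs_ends_conv del_vert_simps)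
  have centre': "x \<rightarrow>\<^sup>*\<^bsub>del_vert v\<^esub> z \<and> z \<rightarrow>\<^sup>*\<^bsub>del_vert v\<^esub> x" if x: "x \<in> pverts G" "x \<noteq> v" for x
    using x(1)
  proof (cases rule: lev_cases)
    case centre
    then show ?thesis using x by (simp add: del_vert_simps)
  next
    case inner
    then have "(x, z) \<in> parcs G" using centre_arc x by blast
    then show ?thesis using x vz arc arcs_symmetric by blast
  next
    case outer
    then obtain y where y: "(x, y) \<in> parcs G" "2 * lev y = lev x" "y \<noteq> v"
      using two_inner_neighbours[OF x(1)] by metis
    then have yz: "(y, z) \<in> parcs G" using centre_arc[of y] outer by (auto dest: in_arcsD2)
    have "x \<rightarrow>\<^bsub>del_vert v\<^esub> y" "y \<rightarrow>\<^bsub>del_vert v\<^esub> z" "z \<rightarrow>\<^bsub>del_vert v\<^esub> y" "y \<rightarrow>\<^bsub>del_vert v\<^esub> x"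
      using arc x y vz yz arcs_symmetric by (metis (full_types))+
    then show ?thesis by (blast intro: D.adj_reachable_trans D.reachable_adjI)
  qed
  then have "x \<rightarrow>\<^sup>*\<^bsub>del_vert v\<^esub> y" if "x \<in> pverts G - {v}" "y \<in> pverts G - {v}" for x y
    using that by (blast intro: D.reachable_trans)
  with assms show False by (auto simp: cut_vertex_def)
qed

lemma out_degree_eq: "out_degree G v = card {w. (v, w) \<in> parcs G}"
proof -
  have "out_arcs G v = Pair v ` {w. (v, w) \<in> parcs G}"
    by (auto simp: out_arcs_def)
  then show ?thesis by (simp add: out_degree_def card_image inj_on_def)
qed

abbreviation level :: "int \<Rightarrow> 'a set" where
  "level k \<equiv> {v \<in> pverts G. lev v = k}"

abbreviation branch :: "'a \<Rightarrow> 'a set" where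
  "branch x \<equiv> {v \<in> pverts G. lev x * lev v > 0}"

abbreviation other_branch :: "'a \<Rightarrow> 'a set" where
  "other_branch x \<equiv> {v \<in> pverts G. lev x * lev v < 0}"

lemma degree_centre: "out_degree G z = 2 * a"
proof -
  have "{w. (z, w) \<in> parcs G} = level 1 \<union> level (-1)"
  proof (intro set_eqI iffI)
    fix w assume "w \<in> {w. (z, w) \<in> parcs G}"
    then have w: "(z, w) \<in> parcs G" "w \<in> pverts G" by (auto dest: in_arcsD2)
    then have "lev w \<noteq> 0" using lev_eq_0_iff[of w] no_loops' by blast
    with lev_arc[OF w(1)] lev_centre w(2) show "w \<in> level 1 \<union> level (-1)" by auto
  next
    fix w assume "w \<in> level 1 \<union> level (-1)"
    then show "w \<in> {w. (z, w) \<in> parcs G}"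
      using centre_arc[of w] arcs_symmetric by auto
  qed
  then show ?thesis
    using card_inner[of 1] card_inner[of "-1"]
    by (simp add: out_degree_eq) (subst card_Un_disjoint; auto)
qed

lemma out_degree_eq_card_branch:
  assumes "x \<in> pverts G" "x \<noteq> z"
  shows "out_degree G x = card {v \<in> branch x. (x, v) \<in> parcs G} + (if \<bar>lev x\<bar> = 1 then 1 else 0)"
proof -
  have same: "v = z \<or> v \<in> branch x" if "(x, v) \<in> parcs G" for v
  proof -
    have v: "v \<in> pverts G" using that by (rule in_arcsD2)
    have "lev x \<noteq> 0" using lev_eq_0_iff assms by blast
    moreover have "v = z \<or> lev v \<noteq> 0" using lev_eq_0_iff v by blast
    ultimately show ?thesis using lev_arc[OF that] v by (auto simp: zero_less_mult_iff)
  qed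
  have "(x, z) \<in> parcs G \<longleftrightarrow> \<bar>lev x\<bar> = 1"
    using lev_arc[of x z] centre_arc[OF assms(1)] lev_centre lev_eq_0_iff[OF assms(1)] assms(2)
    by fastforce
  then have "{v. (x, v) \<in> parcs G} =
      {v \<in> branch x. (x, v) \<in> parcs G} \<union> (if \<bar>lev x\<bar> = 1 then {z} else {})"
    using same by (auto dest: in_arcsD2 split: if_splits)
  then show ?thesis
    by (simp add: out_degree_eq lev_centre)
qed

lemma card_branch:
  assumes "x \<in> pverts G" "x \<noteq> z"
  shows "card (branch x) = a + b"
proof -
  have "lev x \<noteq> 0" using lev_eq_0_iff assms by blast
  then have "branch x = level (sgn (lev x)) \<union> level (2 * sgn (lev x))"
    using lev_le_2 by (auto simp: zero_less_mult_iff sgn_if) (smt (verit))+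
  moreover have "\<bar>sgn (lev x)\<bar> = 1" "\<bar>2 * sgn (lev x)\<bar> = 2"
    using \<open>lev x \<noteq> 0\<close> by (auto simp: sgn_if)
  ultimately show ?thesis
    using card_inner card_outer \<open>lev x \<noteq> 0\<close>
    by (simp, subst card_Un_disjoint) (auto simp: sgn_if)
qed

text \<open>Every other vertex of the own branch contributes one half, and a neighbour another half.\<close>

lemma sum_own_branch:
  assumes x: "x \<in> pverts G" "x \<noteq> z"
  shows "(\<Sum>v \<in> branch x - {x}. 1 / real (graph_dist G v x)) =
    (real a + real b - 1) / 2 + real (card {v \<in> branch x. (x, v) \<in> parcs G}) / 2"
proof -
  let ?B = "branch x - {x}"
  have xB: "x \<in> branch x"
    using x lev_eq_0_iff[of x] by (auto simp: zero_less_mult_iff)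
  have nb: "?B \<inter> {v. (x, v) \<in> parcs G} = {v \<in> branch x. (x, v) \<in> parcs G}"
    using no_loops' by blast
  have "(\<Sum>v \<in> ?B. 1 / real (graph_dist G v x)) =
      (\<Sum>v \<in> ?B. 1 / 2 + (if v \<in> {v. (x, v) \<in> parcs G} then 1 / 2 else 0))"
  proof (rule sum.cong[OF refl])
    fix v assume v: "v \<in> ?B"
    then have "graph_dist G x v = (if (x, v) \<in> parcs G then 1 else 2)"
      using x by (intro graph_dist_within) auto
    then show "1 / real (graph_dist G v x) =
        1 / 2 + (if v \<in> {v. (x, v) \<in> parcs G} then 1 / 2 else 0)"
      by (simp add: graph_dist_sym[of v x])
  qed
  also have "\<dots> = real (card ?B) / 2 + (\<Sum>v \<in> ?B \<inter> {v. (x, v) \<in> parcs G}. 1 / 2)"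
    by (subst sum.inter_restrict) (auto simp: sum.distrib)
  also have "(\<Sum>v \<in> ?B \<inter> {v. (x, v) \<in> parcs G}. 1 / 2) =
      real (card {v \<in> branch x. (x, v) \<in> parcs G}) / 2"
    unfolding nb by simp
  also have "real (card ?B) = real a + real b - 1"
    using xB card_branch[OF x] outer_pos by (simp add: of_nat_diff)
  finally show ?thesis .
qed

lemma sum_other_branch:
  assumes x: "x \<in> pverts G" "x \<noteq> z"
  shows "(\<Sum>v \<in> other_branch x. 1 / real (graph_dist G v x)) =
    real a / (real_of_int \<bar>lev x\<bar> + 1) + real b / (real_of_int \<bar>lev x\<bar> + 2)"
proof -
  have x0: "lev x \<noteq> 0" using lev_eq_0_iff x by blast
  define s where "s = - sgn (lev x)"
  have s: "\<bar>s\<bar> = 1" "\<bar>2 * s\<bar> = 2" "\<bar>lev x - s\<bar> = \<bar>lev x\<bar> + 1" "\<bar>lev x - 2 * s\<bar> = \<bar>lev x\<bar> + 2"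
    and ls: "lev x * s < 0" "lev x * (2 * s) < 0" "s \<noteq> 2 * s"
    using x0 by (auto simp: s_def sgn_if)
  have split: "other_branch x = level s \<union> level (2 * s)"
    using lev_le_2 x0 by (auto simp: s_def mult_less_0_iff sgn_if) (smt (verit))+
  have dist: "real (graph_dist G v x) = real_of_int \<bar>lev x - lev v\<bar>"
    if "v \<in> pverts G" "lev v = s \<or> lev v = 2 * s" for v
  proof -
    have "lev x * lev v \<le> 0" using that(2) ls by (metis less_imp_le)
    then have "int (graph_dist G x v) = \<bar>lev x - lev v\<bar>"
      using graph_dist_across x that by blast
    then show ?thesis by (metis graph_dist_sym of_int_of_nat_eq)
  qed
  have "(\<Sum>v \<in> other_branch x. 1 / real (graph_dist G v x)) =
      (\<Sum>v \<in> level s. 1 / real (graph_dist G v x)) +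
      (\<Sum>v \<in> level (2 * s). 1 / real (graph_dist G v x))"
    unfolding split using ls by (intro sum.union_disjoint) auto
  also have "(\<Sum>v \<in> level s. 1 / real (graph_dist G v x)) = (\<Sum>v \<in> level s. 1 / (real_of_int \<bar>lev x\<bar> + 1))"
    by (intro sum.cong refl) (simp add: dist s)
  also have "(\<Sum>v \<in> level (2 * s). 1 / real (graph_dist G v x)) = (\<Sum>v \<in> level (2 * s). 1 / (real_of_int \<bar>lev x\<bar> + 2))"
    by (intro sum.cong refl) (simp add: dist s)
  finally show ?thesis by (simp add: card_inner card_outer s)
qed

lemma harmonic_centrality_centre: "harmonic_centrality G z = 2 * real a + real b"
proof -
  have "pverts G - {z} = (level 1 \<union> level (-1)) \<union> (level 2 \<union> level (-2))"
    using lev_centre by (auto elim!: lev_cases)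
  moreover have "real (graph_dist G v z) = real_of_int \<bar>lev v\<bar>" if "v \<in> pverts G" for v
    using graph_dist_across[OF that centre] lev_centre
    by (metis diff_zero mult_zero_right of_int_of_nat_eq order_refl)
  ultimately have "harmonic_centrality G z =
      (\<Sum>v \<in> (level 1 \<union> level (-1)) \<union> (level 2 \<union> level (-2)). 1 / real_of_int \<bar>lev v\<bar>)"
    unfolding harmonic_centrality_def by (intro sum.cong) auto
  also have "\<dots> = (\<Sum>v \<in> level 1 \<union> level (-1). 1 / real_of_int \<bar>lev v\<bar>) +
      (\<Sum>v \<in> level 2 \<union> level (-2). 1 / real_of_int \<bar>lev v\<bar>)"
    by (intro sum.union_disjoint) auto
  also have "(\<Sum>v \<in> level 1 \<union> level (-1). 1 / real_of_int \<bar>lev v\<bar>) = real (card (level 1 \<union> level (-1)))"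
    by (subst sum.cong[OF refl, where h = "\<lambda>_. 1"]) auto
  also have "card (level 1 \<union> level (-1)) = 2 * a"
    using card_inner[of 1] card_inner[of "-1"] by (subst card_Un_disjoint) auto
  also have "(\<Sum>v \<in> level 2 \<union> level (-2). 1 / real_of_int \<bar>lev v\<bar>) = real (card (level 2 \<union> level (-2))) / 2"
    by (subst sum.cong[OF refl, where h = "\<lambda>_. 1 / 2"]) auto
  also have "card (level 2 \<union> level (-2)) = 2 * b"
    using card_outer[of 2] card_outer[of "-2"] by (subst card_Un_disjoint) auto
  finally show ?thesis by simp
qed

lemma harmonic_centrality_eq:
  assumes x: "x \<in> pverts G"
  shows "harmonic_centrality G x = 2 * real a + real b"
proof (cases "x = z")
  case True
  then show ?thesis using harmonic_centrality_centre by simp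
next
  case False
  have x0: "lev x \<noteq> 0" using lev_eq_0_iff x False by blast
  have verts: "pverts G - {x} = insert z ((branch x - {x}) \<union> other_branch x)"
  proof -
    have "v = z \<or> lev x * lev v > 0 \<or> lev x * lev v < 0" if "v \<in> pverts G" for v
      using lev_eq_0_iff[OF that] x0 by (metis linorder_neqE_linordered_idom mult_eq_0_iff)
    moreover have "\<not> lev x * lev x < 0" by (simp add: not_less)
    ultimately show ?thesis using False centre by blast
  qed
  have "harmonic_centrality G x = 1 / real (graph_dist G z x) +
      (\<Sum>v \<in> (branch x - {x}) \<union> other_branch x. 1 / real (graph_dist G v x))"
    unfolding harmonic_centrality_def with_proj_simps verts
    by (rule sum.insert) (auto simp: lev_centre)
  also have "(\<Sum>v \<in> (branch x - {x}) \<union> other_branch x. 1 / real (graph_dist G v x)) =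
      (\<Sum>v \<in> branch x - {x}. 1 / real (graph_dist G v x)) +
      (\<Sum>v \<in> other_branch x. 1 / real (graph_dist G v x))"
    by (rule sum.union_disjoint) auto
  also have "real (graph_dist G z x) = real_of_int \<bar>lev x\<bar>"
    using graph_dist_across[OF x centre] lev_centre
    by (metis diff_zero graph_dist_sym mult_zero_right of_int_of_nat_eq order_refl)
  finally have H: "harmonic_centrality G x = 1 / real_of_int \<bar>lev x\<bar> +
      ((real a + real b - 1) / 2 + real (card {v \<in> branch x. (x, v) \<in> parcs G}) / 2 +
       (real a / (real_of_int \<bar>lev x\<bar> + 1) + real b / (real_of_int \<bar>lev x\<bar> + 2)))"
    by (simp add: sum_own_branch[OF x False] sum_other_branch[OF x False])
  have deg: "real (out_degree G x) = real (card {v \<in> branch x. (x, v) \<in> parcs G}) +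
      (if \<bar>lev x\<bar> = 1 then 1 else 0)"
    using out_degree_eq_card_branch[OF x False] by simp
  from x show ?thesis
  proof (cases rule: lev_cases)
    case centre
    with False show ?thesis by simp
  next
    case inner
    then have "real (3 * out_degree G x) = real (6 * a + b)"
      using degree_inner[OF x] by (simp only:)
    with H deg inner show ?thesis by (simp add: field_simps)
  next
    case outer
    then have "real (6 * out_degree G x) = real (14 * a + 3 * b)"
      using degree_outer[OF x] by (simp only:)
    with H deg outer show ?thesis by (simp add: field_simps)
  qed
qed

lemma harmonic_uniform: "harmonic_uniform G"
  using harmonic_uniform_iff[OF fin_digraph] harmonic_centrality_eq by auto

text \<open>An inner vertex has degree \<open>2 a + b/3\<close>, more than the degree \<open>2 a\<close> of \<open>z\<close>.\<close>

lemma not_regular: "\<not> regular_graph G"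
proof
  assume reg: "regular_graph G"
  obtain v w where "v \<in> pverts G" "lev v = 2" "(v, w) \<in> parcs G" "2 * lev w = lev v"
    using exists_outer[of 2] two_inner_neighbours by fastforce
  then have w: "w \<in> pverts G" "lev w = 1" by (auto dest: in_arcsD2)
  have "out_degree G w = out_degree G z"
    using reg w(1) centre unfolding regular_graph_def with_proj_simps by blast
  with degree_inner[OF w(1)] degree_centre w(2) outer_pos show False by simp
qed

end

section \<open>Branches with the required degrees\<close>

text \<open>A vertex is a triple of its level, a block, and a position \<open>i < t\<close> in the block. Six blocks of
  inner and eighteen blocks of outer vertices give \<open>a = 6 t\<close> and \<open>b = 18 t\<close>.\<close>

type_synonym site = "int \<times> nat \<times> nat"

definition sites :: "nat \<Rightarrow> site set" where
  "sites t = {(0, 0, 0)} \<union> {-1, 1} \<times> {..<6 :: nat} \<times> {..<t} \<union> {-2, 2} \<times> {..<18 :: nat} \<times> {..<t}"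

text \<open>
  The required degrees are then \<open>18 t\<close> for inner and \<open>23 t\<close> for outer vertices. In a branch of order
  \<open>24 t\<close> this leaves \<open>6 t\<close> non-neighbours for an inner and only \<open>t - 1\<close> for an outer vertex, so it is
  easier to prescribe the gaps. Inner vertices are pairwise non-adjacent, which accounts for
  \<open>6 t - 1\<close> gaps; the last one is the outer vertex with the same block and position. The outer blocks
  \<open>0, \<dots>, 5\<close> thereby use up one gap at each vertex and need \<open>t - 2\<close> more: blocks \<open>b\<close> and \<open>5 - b\<close>
  are paired, and positions \<open>i\<close> and \<open>j\<close> of paired blocks are adjacent iff \<open>i + j\<close> is congruent to
  \<open>-1\<close> or \<open>-2\<close> modulo \<open>t\<close>, a condition that is symmetric in \<open>i\<close> and \<open>j\<close> and holds for exactly two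
  \<open>j\<close>. Each of the remaining outer blocks is an independent set, with \<open>t - 1\<close> gaps at each vertex.
\<close>

fun outer_gap :: "nat \<Rightarrow> nat \<times> nat \<Rightarrow> nat \<times> nat \<Rightarrow> bool" where
  "outer_gap t (b, i) (c, j) \<longleftrightarrow>
     b + c = 5 \<and> i + j \<notin> {t - 2, t - 1, 2 * t - 2} \<or> b = c \<and> 6 \<le> b"

fun gap :: "nat \<Rightarrow> site \<Rightarrow> site \<Rightarrow> bool" where
  "gap t (k, p) (l, q) \<longleftrightarrow>
     (if k \<noteq> l then p = q else if \<bar>k\<bar> = 1 then True else outer_gap t p q)"

text \<open>Levels that differ by at most one and are both non-zero belong to the same branch, so the
  gaps are consulted only inside a branch.\<close>

fun adj :: "nat \<Rightarrow> site \<Rightarrow> site \<Rightarrow> bool" where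
  "adj t (k, p) (l, q) \<longleftrightarrow>
     (k, p) \<noteq> (l, q) \<and> \<bar>k - l\<bar> \<le> 1 \<and> (k = 0 \<or> l = 0 \<or> \<not> gap t (k, p) (l, q))"

lemma finite_sites: "finite (sites t)"
  by (simp add: sites_def)

lemma card_sites: "card (sites t) = 48 * t + 1"
  unfolding sites_def
  by (subst card_Un_disjoint; (subst card_Un_disjoint)?) (auto simp: card_cartesian_product)

lemma adj_sym: "adj t x y \<longleftrightarrow> adj t y x"
  by (cases x; cases y) (auto simp: add.commute abs_minus_commute)

lemma adj_irrefl: "\<not> adj t x x"
  by (cases x) simp

lemma card_outer_gap_partner:
  assumes "t \<ge> 2" "i < t"
  shows "card {j. j < t \<and> i + j \<notin> {t - 2, t - 1, 2 * t - 2}} = t - 2"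
proof -
  (* The positions whose sum with i is congruent to -1 and to -2 modulo t; for i = t - 1 the
     latter wraps around to the sum 2 * t - 2. *)
  let ?p = "t - 1 - i" and ?q = "if i = t - 1 then t - 1 else t - 2 - i"
  have "{j. j < t \<and> i + j \<notin> {t - 2, t - 1, 2 * t - 2}} = {..<t} - {?p, ?q}"
    using assms by auto
  moreover have "?p \<noteq> ?q" "?p < t" "?q < t"
    using assms by auto
  ultimately show ?thesis by (simp add: card_Diff_subset numeral_2_eq_2)
qed

lemma card_neighbours_inner:
  assumes "\<bar>k\<bar> = 1" "(k, b, i) \<in> sites t"
  shows "card {y \<in> sites t. adj t (k, b, i) y} = 18 * t"
proof -
  have bi: "b < 6" "i < t" using assms by (auto simp: sites_def)
  have k: "k = 1 \<or> k = -1" using assms(1) by linarith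
  let ?O = "{2 * k} \<times> {..<18 :: nat} \<times> {..<t}"
  have "{y \<in> sites t. adj t (k, b, i) y} = insert (0, 0, 0) (?O - {(2 * k, b, i)})"
    using k bi by (auto simp: sites_def)
  moreover have "(2 * k, b, i) \<in> ?O" using bi by simp
  moreover have "card ?O = 18 * t" by (simp add: card_cartesian_product)
  moreover have "0 < t" using bi by simp
  moreover have "(0, 0, 0) \<notin> ?O - {(2 * k, b, i)}" using k by auto
  ultimately show ?thesis by simp
qed

lemma card_neighbours_outer:
  assumes t: "t \<ge> 2" and "\<bar>k\<bar> = 1" "(2 * k, b, i) \<in> sites t"
  shows "card {y \<in> sites t. adj t (2 * k, b, i) y} = 23 * t"
proof -
  have bi: "b < 18" "i < t" using assms by (auto simp: sites_def)
  have k: "k = 1 \<or> k = -1" using assms(2) by linarith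
  let ?N = "{y \<in> sites t. adj t (2 * k, b, i) y}"
  let ?I = "{k} \<times> {..<6 :: nat} \<times> {..<t}"
  let ?O = "{2 * k} \<times> {..<18 :: nat} \<times> {..<t}"
  have card_I: "card ?I = 6 * t" and card_O: "card ?O = 18 * t"
    by (simp_all add: card_cartesian_product)
  show ?thesis
  proof (cases "b < 6")
    case True
    let ?M = "{2 * k} \<times> {5 - b} \<times> {j. j < t \<and> i + j \<notin> {t - 2, t - 1, 2 * t - 2}}"
    have N: "?N = (?I - {(k, b, i)}) \<union> (?O - insert (2 * k, b, i) ?M)"
      using k bi True by (auto simp: sites_def)
    have sub: "insert (2 * k, b, i) ?M \<subseteq> ?O" using True bi by auto
    (* As 5 is odd, no block is its own partner, so the vertex itself is not among its gaps. *)
    have "5 - b \<noteq> b" using True by presburger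
    then have "card (insert (2 * k, b, i) ?M) = t - 1"
      using card_outer_gap_partner[OF t bi(2)] t
      by (subst card_insert_disjoint) (auto simp: card_cartesian_product)
    then have "card (?O - insert (2 * k, b, i) ?M) = 18 * t - (t - 1)"
      using sub card_O by (subst card_Diff_subset) (auto intro: finite_subset)
    moreover have "card (?I - {(k, b, i)}) = 6 * t - 1"
      using True bi card_I by (subst card_Diff_singleton) auto
    ultimately show ?thesis
      unfolding N using k t by (subst card_Un_disjoint) auto
  next
    case False
    let ?M = "{2 * k} \<times> {b} \<times> {..<t}"
    have N: "?N = ?I \<union> (?O - ?M)"
      using k bi False by (auto simp: sites_def)
    have "card (?O - ?M) = 17 * t"
      using bi card_O by (subst card_Diff_subset) (auto simp: card_cartesian_product)
    then show ?thesis
      unfolding N using k card_I by (subst card_Un_disjoint) auto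
  qed
qed

lemma exists_block_avoiding_two:
  obtains d :: nat where "d < 6" "d \<noteq> b" "d \<noteq> c"
proof -
  have "\<exists>d::nat. d < 6 \<and> d \<noteq> b \<and> d \<noteq> c" by presburger
  then show ?thesis using that by blast
qed

text \<open>A block that is paired with no block of the two vertices and equal to none of them is joined
  completely to both: the independent block \<open>17\<close> serves an inner and an outer vertex, and for two
  outer vertices an inner block does.\<close>

lemma common_neighbour_same_branch:
  assumes t: "t \<ge> 2" and x: "(k, b, i) \<in> sites t" and y: "(l, c, j) \<in> sites t"
    and ne: "(k, b, i) \<noteq> (l, c, j)" and sgn: "k * l > 0" and "\<not> adj t (k, b, i) (l, c, j)"
  shows "\<exists>w \<in> sites t. adj t (k, b, i) w \<and> adj t w (l, c, j)"
proof -
  define s where "s = sgn k"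
  have s: "s = 1 \<or> s = -1" "k = s \<or> k = 2 * s" "l = s \<or> l = 2 * s"
    using x y sgn by (auto simp: s_def sites_def)
  then consider "k = s" "l = s" | "k = s" "l = 2 * s" | "k = 2 * s" "l = s" | "k = 2 * s" "l = 2 * s"
    by blast
  then show ?thesis
  proof cases
    case 1
    then have "adj t (k, b, i) (0, 0, 0) \<and> adj t (0, 0, 0) (l, c, j)" using s by auto
    then show ?thesis by (auto simp: sites_def)
  next
    case 2
    then have "b < 6" "c = b" using assms s by (auto simp: sites_def)
    then have "adj t (k, b, i) (2 * s, 17, 0) \<and> adj t (2 * s, 17, 0) (l, c, j)"
      using 2 s by auto
    moreover have "(2 * s, 17, 0) \<in> sites t" using s t by (auto simp: sites_def)
    ultimately show ?thesis by blast
  next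
    case 3
    then have "c < 6" "c = b" using assms s by (auto simp: sites_def)
    then have "adj t (k, b, i) (2 * s, 17, 0) \<and> adj t (2 * s, 17, 0) (l, c, j)"
      using 3 s by auto
    moreover have "(2 * s, 17, 0) \<in> sites t" using s t by (auto simp: sites_def)
    ultimately show ?thesis by blast
  next
    case 4
    obtain d where d: "d < 6" "d \<noteq> b" "d \<noteq> c"
      using exists_block_avoiding_two by blast
    then have "adj t (k, b, i) (s, d, 0) \<and> adj t (s, d, 0) (l, c, j)"
      using 4 s by auto
    moreover have "(s, d, 0) \<in> sites t" using s t d by (auto simp: sites_def)
    ultimately show ?thesis by blast
  qed
qed

declare adj.simps [simp del]

section \<open>Transfer to natural numbers as vertices\<close>

definition two_branch_graph :: "nat \<Rightarrow> nat pair_pre_digraph" where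
  "two_branch_graph t = \<lparr>pverts = to_nat ` sites t,
     parcs = {(to_nat x, to_nat y) | (x :: site) (y :: site). x \<in> sites t \<and> y \<in> sites t \<and> adj t x y}\<rparr>"

definition nat_level :: "nat \<Rightarrow> int" where
  "nat_level v = fst (from_nat v :: site)"

lemma to_nat_eq_iff [simp]: "to_nat x = to_nat y \<longleftrightarrow> x = y"
  by (simp add: inj_eq)

lemma arc_two_branch_graph:
  fixes x y :: site
  shows "(to_nat x, to_nat y) \<in> parcs (two_branch_graph t) \<longleftrightarrow>
    x \<in> sites t \<and> y \<in> sites t \<and> adj t x y"
  by (cases x; cases y) (auto simp: two_branch_graph_def)

lemma nat_level_to_nat [simp]: "nat_level (to_nat (k, p :: nat \<times> nat)) = k"
  by (simp add: nat_level_def)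

lemma pair_graph_two_branch_graph: "pair_graph (two_branch_graph t)"
proof
  have "parcs (two_branch_graph t) \<subseteq> pverts (two_branch_graph t) \<times> pverts (two_branch_graph t)"
    by (auto simp: two_branch_graph_def)
  moreover have "finite (pverts (two_branch_graph t))"
    by (simp add: two_branch_graph_def finite_sites)
  ultimately show "finite (parcs (two_branch_graph t))" by (meson finite_SigmaI finite_subset)
  show "symmetric (two_branch_graph t)"
    using adj_sym by (fastforce simp: symmetric_def sym_def two_branch_graph_def)
qed (auto simp: two_branch_graph_def finite_sites adj_irrefl)

lemma out_degree_two_branch_graph:
  assumes "x \<in> sites t"
  shows "out_degree (two_branch_graph t) (to_nat x) = card {y \<in> sites t. adj t x y}"
proof -
  have "out_arcs (two_branch_graph t) (to_nat x) = (\<lambda>y. (to_nat x, to_nat y)) ` {y \<in> sites t. adj t x y}"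
    using assms by (cases x) (auto simp: out_arcs_def two_branch_graph_def)
  then show ?thesis by (simp add: out_degree_def card_image inj_on_def)
qed

lemma card_level_two_branch_graph:
  "card {v \<in> pverts (two_branch_graph t). nat_level v = k} = card {x \<in> sites t. fst x = k}"
proof -
  have "{v \<in> pverts (two_branch_graph t). nat_level v = k} = to_nat ` {x \<in> sites t. fst x = k}"
    by (auto simp: two_branch_graph_def nat_level_def)
  then show ?thesis by (simp add: card_image inj_on_def)
qed

lemma balanced_gluing_two_branch_graph:
  assumes t: "t \<ge> 2"
  shows "balanced_gluing (two_branch_graph t) nat_level
    (to_nat (0 :: int, 0 :: nat, 0 :: nat)) (6 * t) (18 * t)"
proof -
  let ?G = "two_branch_graph t"
  interpret pair_graph ?G by (rule pair_graph_two_branch_graph)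
  have verts: "\<exists>k b i. v = to_nat (k, b, i) \<and> (k, b, i) \<in> sites t" if "v \<in> pverts ?G" for v
    using that by (auto simp: two_branch_graph_def)
  show ?thesis
  proof
    show "to_nat (0 :: int, 0 :: nat, 0 :: nat) \<in> pverts ?G"
      by (auto simp: two_branch_graph_def sites_def)
    show "0 < 18 * t" using t by simp
  next
    fix v assume "v \<in> pverts ?G"
    then obtain k b i where v: "v = to_nat (k, b, i)" "(k, b, i) \<in> sites t" using verts by blast
    show "nat_level v = 0 \<longleftrightarrow> v = to_nat (0 :: int, 0 :: nat, 0 :: nat)" "\<bar>nat_level v\<bar> \<le> 2"
      using v by (auto simp: sites_def)
    show "(v, to_nat (0 :: int, 0 :: nat, 0 :: nat)) \<in> parcs ?G" if "\<bar>nat_level v\<bar> = 1"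
      using v that by (auto simp: arc_two_branch_graph sites_def adj.simps)
    show "3 * out_degree ?G v = 6 * (6 * t) + 18 * t" if "\<bar>nat_level v\<bar> = 1"
      using v that by (simp add: out_degree_two_branch_graph card_neighbours_inner)
    show "6 * out_degree ?G v = 14 * (6 * t) + 3 * (18 * t)" if "\<bar>nat_level v\<bar> = 2"
    proof -
      from that have "k = 2 * 1 \<or> k = 2 * (-1)" using v(1) by auto
      then obtain s where "k = 2 * s" "\<bar>s\<bar> = 1"
        by force
      with v t show ?thesis by (simp add: out_degree_two_branch_graph card_neighbours_outer)
    qed
    show "\<exists>x y. x \<noteq> y \<and> (v, x) \<in> parcs ?G \<and> (v, y) \<in> parcs ?G \<and>
        2 * nat_level x = nat_level v \<and> 2 * nat_level y = nat_level v" if "\<bar>nat_level v\<bar> = 2"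
    proof -
      from that have "k = 2 * 1 \<or> k = 2 * (-1)" using v(1) by auto
      then obtain s where s: "k = 2 * s" "s = 1 \<or> s = -1"
        by force
      obtain d where d: "d < 6" "d \<noteq> b" using exists_block_avoiding_two by blast
      let ?x = "to_nat (s, d, 0 :: nat)" and ?y = "to_nat (s, d, 1 :: nat)"
      have "(v, ?x) \<in> parcs ?G" "(v, ?y) \<in> parcs ?G"
        using v s d t by (auto simp: arc_two_branch_graph sites_def adj.simps)
      then show ?thesis using v s by (intro exI[of _ ?x] exI[of _ ?y]) auto
    qed
  next
    fix u v assume "(u, v) \<in> parcs ?G"
    then show "\<bar>nat_level u - nat_level v\<bar> \<le> 1"
      by (auto simp: two_branch_graph_def adj.simps)
  next
    fix u v assume *: "u \<in> pverts ?G" "v \<in> pverts ?G" "u \<noteq> v"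
      "nat_level u * nat_level v > 0" "(u, v) \<notin> parcs ?G"
    obtain k b i where u: "u = to_nat (k, b, i)" "(k, b, i) \<in> sites t" using verts *(1) by blast
    obtain l c j where v: "v = to_nat (l, c, j)" "(l, c, j) \<in> sites t" using verts *(2) by blast
    have "(k, b, i) \<noteq> (l, c, j)" "k * l > 0" "\<not> adj t (k, b, i) (l, c, j)"
      using *(3-5) u v by (simp_all only: arc_two_branch_graph nat_level_to_nat simp_thms) auto
    then obtain w where "w \<in> sites t" "adj t (k, b, i) w" "adj t w (l, c, j)"
      using common_neighbour_same_branch[OF t u(2) v(2)] by blast
    then have "(u, to_nat w) \<in> parcs ?G \<and> (to_nat w, v) \<in> parcs ?G"
      using u v by (simp add: arc_two_branch_graph)
    then show "\<exists>w. (u, w) \<in> parcs ?G \<and> (w, v) \<in> parcs ?G" by blast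
  next
    fix k :: int assume "\<bar>k\<bar> = 1"
    then have "{x \<in> sites t. fst x = k} = {k} \<times> {..<6 :: nat} \<times> {..<t}"
      by (auto simp: sites_def)
    then show "card {v \<in> pverts ?G. nat_level v = k} = 6 * t"
      by (simp add: card_level_two_branch_graph card_cartesian_product)
  next
    fix k :: int assume "\<bar>k\<bar> = 2"
    then have "{x \<in> sites t. fst x = k} = {k} \<times> {..<18 :: nat} \<times> {..<t}"
      by (auto simp: sites_def)
    then show "card {v \<in> pverts ?G. nat_level v = k} = 18 * t"
      by (simp add: card_level_two_branch_graph card_cartesian_product)
  qed
qed

theorem theorem6:
  fixes t :: nat
  assumes "t \<ge> 2"
  shows "\<exists>F :: nat pair_pre_digraph.
    pair_graph F \<and> Digraph_Component.connected F \<and> \<not> regular_graph F \<and> harmonic_uniform F \<and>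
    (\<exists>!v. cut_vertex F v) \<and> card (verts F) = 48 * t + 1 \<and> graph_diam F = 4"
proof -
  interpret balanced_gluing "two_branch_graph t" nat_level
    "to_nat (0 :: int, 0 :: nat, 0 :: nat)" "6 * t" "18 * t"
    using assms by (rule balanced_gluing_two_branch_graph)
  have "card (verts (two_branch_graph t)) = 48 * t + 1"
    by (simp add: two_branch_graph_def card_image card_sites)
  then show ?thesis
    using pair_graph connected not_regular harmonic_uniform cut_vertex_centre cut_vertex_imp_centre
      graph_diam by blast
qed

end
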